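(* Let $\bm{Q}\in\mathbb{R}^{p\times p}$ be a symmetric positive definite matrix, let $\bm{x}\in\mathbb{R}^p$ with $\bm{x}\neq \bm{0}$, and let $y\in\{-1,1\}$. Consider the set $$W_Q=\Big\{(\bm{w},z,t)\in\mathbb{R}^p\times\{0,1\}\times\mathbb{R}:\ t\geq \bm{w}^\top \bm{Q}\bm{w},\ \big(1-y(\bm{x}^\top \bm{w})\big)(1-z)\leq 0,\ \big(1-y(\bm{x}^\top \bm{w})\big)z\geq 0\Big\}.$$ Then the convex hull of $W_Q$ is the set of all $(\bm{w},z,t)\in\mathbb{R}^p\times\mathbb{R}\times\mathbb{R}$ satisfying the bound constraints $0\leq z\leq 1$ and the inequality $$t\geq \bm{w}^\top \bm{Q}\bm{w}-\gamma\big(1-y(\bm{x}^\top \bm{w})\big)^2+\gamma\frac{\big(1-y(\bm{x}^\top \bm{w})\big)_+^2}{z}+\gamma\frac{\big(1-y(\bm{x}^\top \bm{w})\big)_-^2}{1-z},$$ where $\gamma\in\mathbb{R}_+$ is the largest number such that the function $\bm{w}\mapsto\bm{w}^\top \bm{Q}\bm{w}-\gamma\big(1-y(\bm{x}^\top \bm{w})\big)^2$ is convex, and this number is given by $\gamma=1/(\bm{x}^\top \bm{Q}^{-1}\bm{x})$.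
   Context: For $\alpha\in\mathbb{R}$, $(\alpha)_+:=\max\{\alpha,0\}$ and $(\alpha)_-:=\max\{-\alpha,0\}$, and $(\alpha)_\pm^2:=((\alpha)_\pm)^2$ (the positive/negative part is taken before squaring). Convention for division by $0$: for $a\in\mathbb{R}$, $a^2/0=0$ if $a=0$ and $a^2/0=+\infty$ otherwise. *)

theory Defs
  imports "HOL-Analysis.Analysis"
begin

definition posdef_matrix :: "real ^ 'n ^ 'n \<Rightarrow> bool" where
  "posdef_matrix Q \<longleftrightarrow> transpose Q = Q \<and> (\<forall>v. v \<noteq> 0 \<longrightarrow> v \<bullet> (Q *v v) > 0)"

definition ppart :: "real \<Rightarrow> real" where
  "ppart a = max a 0"

definition npart :: "real \<Rightarrow> real" where
  "npart a = max (- a) 0"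

text \<open>The extended quotient \<open>a\<^sup>2 / b\<close>. HOL's real division yields \<open>a\<^sup>2 / 0 = 0\<close> for every
  \<open>a\<close>, so the values at \<open>b = 0\<close> are given explicitly.\<close>

definition sq_over :: "real \<Rightarrow> real \<Rightarrow> ereal" where
  "sq_over a b = (if b = 0 then (if a = 0 then 0 else \<infinity>) else ereal (a\<^sup>2 / b))"

definition hinge :: "real ^ 'n \<Rightarrow> real \<Rightarrow> real ^ 'n \<Rightarrow> real" where
  "hinge x y w = 1 - y * (x \<bullet> w)"

definition W_set :: "real ^ 'n ^ 'n \<Rightarrow> real ^ 'n \<Rightarrow> real \<Rightarrow> ((real ^ 'n) \<times> real \<times> real) set" where
  "W_set Q x y = {(w, z, t). z \<in> {0, 1} \<and> t \<ge> w \<bullet> (Q *v w) \<and>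
     hinge x y w * (1 - z) \<le> 0 \<and> hinge x y w * z \<ge> 0}"

definition residual_quadratic ::
    "real ^ 'n ^ 'n \<Rightarrow> real ^ 'n \<Rightarrow> real \<Rightarrow> real \<Rightarrow> real ^ 'n \<Rightarrow> real" where
  "residual_quadratic Q x y \<gamma> w = w \<bullet> (Q *v w) - \<gamma> * (hinge x y w)\<^sup>2"

definition largest_convex_coeff ::
    "real ^ 'n ^ 'n \<Rightarrow> real ^ 'n \<Rightarrow> real \<Rightarrow> real \<Rightarrow> bool" where
  "largest_convex_coeff Q x y \<gamma> \<longleftrightarrow>
     \<gamma> \<ge> 0 \<and> convex_on UNIV (residual_quadratic Q x y \<gamma>) \<and>
     (\<forall>\<delta>\<ge>0. convex_on UNIV (residual_quadratic Q x y \<delta>) \<longrightarrow> \<delta> \<le> \<gamma>)"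

definition hull_set ::
    "real ^ 'n ^ 'n \<Rightarrow> real ^ 'n \<Rightarrow> real \<Rightarrow> real \<Rightarrow> ((real ^ 'n) \<times> real \<times> real) set" where
  "hull_set Q x y \<gamma> = {(w, z, t). 0 \<le> z \<and> z \<le> 1 \<and>
     ereal t \<ge> ereal (residual_quadratic Q x y \<gamma> w)
       + ereal \<gamma> * sq_over (ppart (hinge x y w)) z
       + ereal \<gamma> * sq_over (npart (hinge x y w)) (1 - z)}"

end

theory Submission
  imports Defs
begin

text \<open>Put \<open>v = \<gamma> Q\<^sup>-\<^sup>1 x\<close>. The residual quadratic is a positive semidefinite
  form plus an affine function, and it is affine along \<open>v\<close>. For \<open>b \<ge> 0\<close> the extended
  quotient \<open>a\<^sup>2 / b\<close> is the supremum of \<open>2 c a - c\<^sup>2 b\<close> over \<open>c\<close>, so the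
  candidate hull is an intersection of epigraphs of convex functions, which gives one inclusion.
  Conversely, a point with \<open>0 < z < 1\<close> is split by moving \<open>w\<close> along \<open>v\<close> in both directions
  until the hinge equals \<open>h\<^sub>+ / z\<close> and \<open>- h\<^sub>- / (1 - z)\<close>; as the residual is affine
  along \<open>v\<close>, the split attains the bound.\<close>

section \<open>The residual quadratic along lines\<close>

lemma symmetric_matrix_inner:
  fixes Q :: "real ^ 'n ^ 'n"
  assumes "transpose Q = Q"
  shows "a \<bullet> (Q *v b) = (Q *v a) \<bullet> b"
  by (metis assms dot_lmul_matrix transpose_matrix_vector)

text \<open>Restricting to a line serves two purposes: the sign of the \<open>s\<^sup>2\<close>
  coefficient decides convexity, and its vanishing for a suitable direction makes the residual
  affine there. Since \<open>y\<^sup>2 = 1\<close>, this coefficient depends on \<open>d\<close>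
  alone.\<close>

lemma residual_quadratic_line:
  fixes Q :: "real ^ 'n ^ 'n"
  assumes "transpose Q = Q" and "y\<^sup>2 = 1"
  shows "residual_quadratic Q x y \<gamma> (a + s *\<^sub>R d) = residual_quadratic Q x y \<gamma> a
    + s * (2 * (a \<bullet> (Q *v d)) + 2 * \<gamma> * (y - x \<bullet> a) * (x \<bullet> d))
    + s\<^sup>2 * (d \<bullet> (Q *v d) - \<gamma> * (x \<bullet> d)\<^sup>2)"
proof -
  have "d \<bullet> (Q *v a) = a \<bullet> (Q *v d)"
    by (metis symmetric_matrix_inner[OF assms(1)] inner_commute)
  then have q: "(a + s *\<^sub>R d) \<bullet> (Q *v (a + s *\<^sub>R d))
      = a \<bullet> (Q *v a) + 2 * s * (a \<bullet> (Q *v d)) + s\<^sup>2 * (d \<bullet> (Q *v d))"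
    by (simp add: power2_eq_square algebra_simps)
  have "(hinge x y (a + s *\<^sub>R d))\<^sup>2 = (hinge x y a - s * (y * (x \<bullet> d)))\<^sup>2"
    by (simp add: hinge_def algebra_simps)
  also have "\<dots> = (hinge x y a)\<^sup>2 - 2 * s * (y - y\<^sup>2 * (x \<bullet> a)) * (x \<bullet> d) + s\<^sup>2 * y\<^sup>2 * (x \<bullet> d)\<^sup>2"
    by (simp add: hinge_def power2_eq_square algebra_simps)
  finally have h: "(hinge x y (a + s *\<^sub>R d))\<^sup>2
      = (hinge x y a)\<^sup>2 - 2 * s * (y - x \<bullet> a) * (x \<bullet> d) + s\<^sup>2 * (x \<bullet> d)\<^sup>2"
    using assms(2) by simp
  show ?thesis
    unfolding residual_quadratic_def q h by (simp add: algebra_simps)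
qed

lemma convex_on_residual_quadratic:
  fixes Q :: "real ^ 'n ^ 'n"
  assumes "transpose Q = Q" and "y\<^sup>2 = 1"
    and psd: "\<And>d. \<gamma> * (x \<bullet> d)\<^sup>2 \<le> d \<bullet> (Q *v d)"
  shows "convex_on UNIV (residual_quadratic Q x y \<gamma>)"
proof (rule convex_onI)
  fix s :: real and a b :: "real ^ 'n"
  assume s: "0 < s" "s < 1"
  let ?R = "residual_quadratic Q x y \<gamma>" and ?d = "b - a"
  note line = residual_quadratic_line[OF assms(1,2), of x \<gamma> a _ ?d]
  define L P where "L = 2 * (a \<bullet> (Q *v ?d)) + 2 * \<gamma> * (y - x \<bullet> a) * (x \<bullet> ?d)"
    and "P = ?d \<bullet> (Q *v ?d) - \<gamma> * (x \<bullet> ?d)\<^sup>2"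
  have b: "?R b = ?R a + L + P"
    using line[of 1] by (simp add: L_def P_def)
  have "(1 - s) *\<^sub>R a + s *\<^sub>R b = a + s *\<^sub>R ?d"
    by (simp add: algebra_simps)
  then have m: "?R ((1 - s) *\<^sub>R a + s *\<^sub>R b) = ?R a + s * L + s\<^sup>2 * P"
    using line[of s] by (simp add: L_def P_def)
  \<comment> \<open>This is exactly the gap between the chord and the function at parameter
    \<open>s\<close>.\<close>
  have "0 \<le> s * (1 - s) * P"
    using s psd[of ?d] by (simp add: P_def)
  then show "?R ((1 - s) *\<^sub>R a + s *\<^sub>R b) \<le> (1 - s) * ?R a + s * ?R b"
    unfolding b m by (simp add: power2_eq_square algebra_simps)
qed simp

section \<open>The dual description and the inclusion of the hull\<close>

lemma convex_hull_set_dual: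
  assumes "convex_on UNIV (residual_quadratic Q x y \<gamma>)"
  shows "convex {(w, z, t). 0 \<le> z \<and> z \<le> 1 \<and> (\<forall>c\<ge>0. \<forall>d\<ge>0.
    residual_quadratic Q x y \<gamma> w + \<gamma> * (2 * c * hinge x y w - c\<^sup>2 * z)
      + \<gamma> * (- 2 * d * hinge x y w - d\<^sup>2 * (1 - z)) \<le> t)}" (is "convex ?C")
proof (rule convexI)
  fix p p' and u v :: real
  assume p: "p \<in> ?C" and p': "p' \<in> ?C" and uv: "0 \<le> u" "0 \<le> v" "u + v = 1"
  obtain w z t where pe: "p = (w, z, t)" by (cases p)
  obtain w' z' t' where pe': "p' = (w', z', t')" by (cases p')
  let ?R = "residual_quadratic Q x y \<gamma>" and ?h = "hinge x y"
  have h: "?h (u *\<^sub>R w + v *\<^sub>R w') = u * ?h w + v * ?h w'"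
  proof -
    have "u * ?h w + v * ?h w' = (u + v) - y * (u * (x \<bullet> w) + v * (x \<bullet> w'))"
      by (simp add: hinge_def algebra_simps)
    then show ?thesis using uv by (simp add: hinge_def inner_add_right)
  qed
  have R: "?R (u *\<^sub>R w + v *\<^sub>R w') \<le> u * ?R w + v * ?R w'"
    using assms uv by (simp add: convex_on_def)
  have z1: "u * z + v * z' \<le> 1"
    using p p' pe pe' uv by (intro convex_bound_le) auto
  have "?R (u *\<^sub>R w + v *\<^sub>R w') + \<gamma> * (2 * c * ?h (u *\<^sub>R w + v *\<^sub>R w') - c\<^sup>2 * (u * z + v * z'))
      + \<gamma> * (- 2 * d * ?h (u *\<^sub>R w + v *\<^sub>R w') - d\<^sup>2 * (1 - (u * z + v * z')))
      \<le> u * t + v * t'" if cd: "0 \<le> c" "0 \<le> d" for c d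
  proof -
    \<comment> \<open>For fixed \<open>c\<close> and \<open>d\<close> this is the convex residual
      plus an affine function of \<open>(w, z)\<close>. Below, the constant 1 of
      \<open>1 - z\<close> is kept as \<open>u + v\<close>, so that the regrouping is a polynomial
      identity.\<close>
    let ?e = "\<lambda>w z. ?R w + \<gamma> * (2 * c * ?h w - c\<^sup>2 * z) + \<gamma> * (- 2 * d * ?h w - d\<^sup>2 * (1 - z))"
    have "u * ?e w z + v * ?e w' z' \<le> u * t + v * t'"
      using p p' pe pe' uv cd by (intro add_mono mult_left_mono) auto
    moreover have "u * ?e w z + v * ?e w' z' = u * ?R w + v * ?R w'
        + \<gamma> * (2 * c * (u * ?h w + v * ?h w') - c\<^sup>2 * (u * z + v * z'))
        + \<gamma> * (- 2 * d * (u * ?h w + v * ?h w') - d\<^sup>2 * ((u + v) - (u * z + v * z')))"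
      by (simp add: algebra_simps)
    ultimately show ?thesis using R uv(3) h by simp
  qed
  then show "u *\<^sub>R p + v *\<^sub>R p' \<in> ?C"
    using z1 uv p p' pe pe' by simp
qed

lemma hull_set_dualI:
  fixes Q :: "real ^ 'n ^ 'n"
  assumes "0 < \<gamma>" and z: "0 \<le> z" "z \<le> 1"
    and dual: "\<And>c d. 0 \<le> c \<Longrightarrow> 0 \<le> d \<Longrightarrow>
      residual_quadratic Q x y \<gamma> w + \<gamma> * (2 * c * hinge x y w - c\<^sup>2 * z)
        + \<gamma> * (- 2 * d * hinge x y w - d\<^sup>2 * (1 - z)) \<le> t"
  shows "(w, z, t) \<in> hull_set Q x y \<gamma>"
proof -
  let ?R = "residual_quadratic Q x y \<gamma> w"
  define h where "h = hinge x y w"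
  note dual = dual[folded h_def]
  have z0: "h \<le> 0" if "z = 0"
  proof (rule ccontr)
    assume "\<not> h \<le> 0"
    then have h: "h > 0" by simp
    \<comment> \<open>At \<open>z = 0\<close> the bound is linear in \<open>c\<close> with slope
      \<open>2 * \<gamma> * h\<close>. This \<open>c\<close> pushes it past \<open>t\<close>. The
      case \<open>z = 1\<close> is symmetric in \<open>d\<close>.\<close>
    define c where "c = (\<bar>t - ?R\<bar> + 1) / (2 * \<gamma> * h)"
    have "c \<ge> 0" using h assms(1) by (simp add: c_def)
    moreover have "\<gamma> * (2 * c * h) = \<bar>t - ?R\<bar> + 1"
      using h assms(1) by (simp add: c_def field_simps)
    ultimately show False using dual[of c 0] that by simp
  qed
  have z1: "h \<ge> 0" if "z = 1"
  proof (rule ccontr)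
    assume "\<not> h \<ge> 0"
    then have h: "h < 0" by simp
    define d where "d = (\<bar>t - ?R\<bar> + 1) / (2 * \<gamma> * (- h))"
    have "d \<ge> 0" using h assms(1) by (simp add: d_def divide_nonneg_nonpos mult_nonneg_nonpos)
    moreover have "\<gamma> * (- 2 * d * h) = \<bar>t - ?R\<bar> + 1"
      using h assms(1) by (simp add: d_def field_simps)
    ultimately show False using dual[of 0 d] that by simp
  qed
  \<comment> \<open>The maximiser of \<open>2 * c * b - c\<^sup>2 * r\<close> is
    \<open>c = b / r\<close>. For \<open>r = 0\<close> both sides are 0 by HOL's division, so
    \<open>pos\<close> and \<open>neg\<close> also cover the endpoints; there \<open>z0\<close> and
    \<open>z1\<close> exclude the infinite value of \<open>sq_over\<close>.\<close>
  have opt: "2 * (b / r) * b - (b / r)\<^sup>2 * r = b\<^sup>2 / r" for b r :: real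
    by (cases "r = 0") (simp_all add: field_simps power2_eq_square)
  have pos: "?R + \<gamma> * (h\<^sup>2 / z) \<le> t" if "h \<ge> 0"
    using dual[of "h / z" 0] opt[of h z] z that by simp
  have neg: "?R + \<gamma> * (h\<^sup>2 / (1 - z)) \<le> t" if "h \<le> 0"
    using dual[of 0 "- h / (1 - z)"] opt[of "- h" "1 - z"] z that by (simp add: divide_nonpos_nonneg)
  show ?thesis
    using z z0 z1 pos neg
    by (cases "h \<ge> 0") (auto simp: hull_set_def h_def[symmetric] sq_over_def ppart_def npart_def max_def)
qed

lemma W_set_dual:
  assumes "0 \<le> \<gamma>" and "(w, z, t) \<in> W_set Q x y" and cd: "0 \<le> c" "0 \<le> d"
  shows "residual_quadratic Q x y \<gamma> w + \<gamma> * (2 * c * hinge x y w - c\<^sup>2 * z)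
    + \<gamma> * (- 2 * d * hinge x y w - d\<^sup>2 * (1 - z)) \<le> t"
proof -
  define h where "h = hinge x y w"
  have "z = 0 \<and> h \<le> 0 \<or> z = 1 \<and> h \<ge> 0" and t: "w \<bullet> (Q *v w) \<le> t"
    using assms(2) by (auto simp: W_set_def h_def)
  \<comment> \<open>The multiplier term that survives is bounded by completing a square, and the
    other one has a favourable sign. Scaled by \<open>\<gamma>\<close>, the bound
    \<open>h\<^sup>2\<close> restores what the residual subtracts.\<close>
  then have "(2 * c * h - c\<^sup>2 * z) + (- 2 * d * h - d\<^sup>2 * (1 - z)) \<le> h\<^sup>2"
  proof (elim disjE conjE)
    assume "z = 0" "h \<le> 0"
    moreover have "c * h \<le> 0" using cd \<open>h \<le> 0\<close> by (simp add: mult_nonneg_nonpos)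
    ultimately show ?thesis
      using zero_le_power2[of "h + d"] by (simp add: power2_eq_square algebra_simps)
  next
    assume "z = 1" "h \<ge> 0"
    moreover have "d * h \<ge> 0" using cd \<open>h \<ge> 0\<close> by simp
    ultimately show ?thesis
      using zero_le_power2[of "h - c"] by (simp add: power2_eq_square algebra_simps)
  qed
  from mult_left_mono[OF this assms(1)] t show ?thesis
    by (simp add: residual_quadratic_def h_def[symmetric] algebra_simps)
qed

section \<open>Splitting a point into two points of the original set\<close>

lemma hull_set_subset_convex_hull:
  fixes Q :: "real ^ 'n ^ 'n"
  assumes sym: "transpose Q = Q" and y: "y\<^sup>2 = 1" and "0 < \<gamma>"
    and v: "Q *v v = \<gamma> *\<^sub>R x" "x \<bullet> v = 1"
  shows "hull_set Q x y \<gamma> \<subseteq> convex hull (W_set Q x y)"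
proof clarify
  fix w z t
  assume hs: "(w, z, t) \<in> hull_set Q x y \<gamma>"
  let ?R = "residual_quadratic Q x y \<gamma>"
  define h where "h = hinge x y w"
  have z: "0 \<le> z" "z \<le> 1" using hs by (auto simp: hull_set_def)
  consider "z = 0" | "z = 1" | "0 < z" "z < 1" using z by linarith
  then show "(w, z, t) \<in> convex hull (W_set Q x y)"
  proof cases
    \<comment> \<open>As \<open>\<gamma> > 0\<close>, finiteness of the right-hand side forces
      \<open>h \<le> 0\<close>; the other quotient is then \<open>h\<^sup>2\<close> and cancels the
      subtracted square. Case 2 mirrors this.\<close>
    case 1
    then have "(w, z, t) \<in> W_set Q x y"
      using hs assms(3)
      by (auto simp: hull_set_def W_set_def sq_over_def ppart_def npart_def max_def
          residual_quadratic_def split: if_splits)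
    then show ?thesis by (rule hull_inc)
  next
    case 2
    then have "(w, z, t) \<in> W_set Q x y"
      using hs assms(3)
      by (auto simp: hull_set_def W_set_def sq_over_def ppart_def npart_def max_def
          residual_quadratic_def split: if_splits)
    then show ?thesis by (rule hull_inc)
  next
    case 3
    define h1 h0 where "h1 = ppart h / z" and "h0 = - npart h / (1 - z)"
    \<comment> \<open>The hinge has slope \<open>- y\<close> along \<open>v\<close> because
      \<open>x \<bullet> v = 1\<close>, so a step of \<open>y * (h - a)\<close> brings it to
      \<open>a\<close>.\<close>
    define w1 w0 where "w1 = w + (y * (h - h1)) *\<^sub>R v" and "w0 = w + (y * (h - h0)) *\<^sub>R v"
    have sgn: "0 \<le> h1" "h0 \<le> 0"
      using 3 by (simp_all add: h1_def h0_def ppart_def npart_def)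
    have mean: "z * h1 + (1 - z) * h0 = h"
      using 3 by (simp add: h1_def h0_def ppart_def npart_def max_def)
    have tR: "?R w + \<gamma> * (z * h1\<^sup>2) + \<gamma> * ((1 - z) * h0\<^sup>2) \<le> t"
    proof -
      have "z * h1\<^sup>2 = (ppart h)\<^sup>2 / z" "(1 - z) * h0\<^sup>2 = (npart h)\<^sup>2 / (1 - z)"
        using 3 by (simp_all add: h1_def h0_def power_divide power2_eq_square)
      then show ?thesis using hs 3 by (simp add: hull_set_def sq_over_def h_def)
    qed
    have yy: "y * (y * a) = a" for a
      using y by (simp add: power2_eq_square flip: mult.assoc)
    have hinge: "hinge x y (w + (y * (h - a)) *\<^sub>R v) = a" for a
    proof -
      have "hinge x y (w + (y * (h - a)) *\<^sub>R v) = h - y * (y * (h - a))"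
        using v(2) by (simp add: hinge_def inner_add_right distrib_left h_def)
      then show ?thesis using yy[of "h - a"] by simp
    qed
    \<comment> \<open>The second-order coefficient vanishes because
      \<open>v \<bullet> (Q *v v) = \<gamma>\<close> and \<open>x \<bullet> v = 1\<close>. The slope
      along \<open>v\<close> is \<open>2 * \<gamma> * y\<close>.\<close>
    have R: "?R (w + (y * s) *\<^sub>R v) = ?R w + 2 * \<gamma> * s" for s
      using residual_quadratic_line[OF sym y, of x \<gamma> w "y * s" v] v yy[of s]
      by (simp add: inner_commute algebra_simps)
    have q1: "w1 \<bullet> (Q *v w1) = ?R w + 2 * \<gamma> * (h - h1) + \<gamma> * h1\<^sup>2"
      using R[of "h - h1"] hinge[of h1] by (simp add: residual_quadratic_def w1_def)
    have q0: "w0 \<bullet> (Q *v w0) = ?R w + 2 * \<gamma> * (h - h0) + \<gamma> * h0\<^sup>2"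
      using R[of "h - h0"] hinge[of h0] by (simp add: residual_quadratic_def w0_def)
    \<comment> \<open>The slack of \<open>(w, z, t)\<close>, nonnegative by \<open>tR\<close>.
      Adding it to both heights makes their mean exactly \<open>t\<close>, since the linear terms in
      \<open>q1\<close> and \<open>q0\<close> average to zero by \<open>mean\<close>.\<close>
    define e where "e = t - (?R w + \<gamma> * (z * h1\<^sup>2) + \<gamma> * ((1 - z) * h0\<^sup>2))"
    define t1 t0 where "t1 = w1 \<bullet> (Q *v w1) + e" and "t0 = w0 \<bullet> (Q *v w0) + e"
    have W: "(w1, 1, t1) \<in> W_set Q x y" "(w0, 0, t0) \<in> W_set Q x y"
      using hinge[of h1] hinge[of h0] sgn tR
      by (auto simp: W_set_def w1_def[symmetric] w0_def[symmetric] t1_def t0_def e_def)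
    have "z *\<^sub>R w1 + (1 - z) *\<^sub>R w0
        = w + (y * (h - (z * h1 + (1 - z) * h0))) *\<^sub>R v"
      by (simp add: w1_def w0_def algebra_simps)
    then have we: "z *\<^sub>R w1 + (1 - z) *\<^sub>R w0 = w" using mean by simp
    have "z * t1 + (1 - z) * t0
        = t + 2 * \<gamma> * (h - (z * h1 + (1 - z) * h0))"
      unfolding t1_def t0_def q1 q0 e_def by (simp add: algebra_simps)
    then have te: "z * t1 + (1 - z) * t0 = t" using mean by simp
    have "z *\<^sub>R (w1, 1, t1) + (1 - z) *\<^sub>R (w0, 0, t0) \<in> convex hull (W_set Q x y)"
      using 3 W by (intro convexD[OF convex_convex_hull]) (auto intro: hull_inc)
    then show ?thesis using we te by simp
  qed
qed

section \<open>The coefficient \<gamma>: maximality and closed form\<close>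

lemma largest_convex_coeff_residual:
  fixes Q :: "real ^ 'n ^ 'n"
  assumes "posdef_matrix Q" and y: "y\<^sup>2 = 1" and "0 < \<gamma>"
    and v: "Q *v v = \<gamma> *\<^sub>R x" "x \<bullet> v = 1"
  shows "largest_convex_coeff Q x y \<gamma>"
proof -
  have sym: "transpose Q = Q" and psd: "0 \<le> d \<bullet> (Q *v d)" for d
    using assms(1) by (cases "d = 0"; auto simp: posdef_matrix_def intro: less_imp_le)+
  have vQ: "v \<bullet> (Q *v d) = \<gamma> * (x \<bullet> d)" for d
    using v by (simp add: symmetric_matrix_inner[OF sym])
  \<comment> \<open>Cauchy-Schwarz for the inner product of \<open>Q\<close>: subtracting
    \<open>(x \<bullet> d) *\<^sub>R v\<close> removes from \<open>d\<close> its
    \<open>Q\<close>-component along \<open>v\<close>, and the remainder has nonnegative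
    \<open>Q\<close>-norm.\<close>
  have "\<gamma> * (x \<bullet> d)\<^sup>2 \<le> d \<bullet> (Q *v d)" for d
    using psd[of "d - (x \<bullet> d) *\<^sub>R v"] v vQ
    by (simp add: inner_commute power2_eq_square algebra_simps)
  then have conv: "convex_on UNIV (residual_quadratic Q x y \<gamma>)"
    by (rule convex_on_residual_quadratic[OF sym y])
  have "\<delta> \<le> \<gamma>" if "convex_on UNIV (residual_quadratic Q x y \<delta>)" for \<delta>
  proof -
    let ?R = "residual_quadratic Q x y \<delta>"
    \<comment> \<open>Midpoint convexity at \<open>v\<close> and \<open>- v\<close> reads
      \<open>- \<delta> \<le> \<gamma> - 2 * \<delta>\<close>.\<close>
    have "?R ((1 - 1/2) *\<^sub>R v + (1/2) *\<^sub>R (- v)) \<le> (1 - 1/2) * ?R v + (1/2) * ?R (- v)"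
      by (rule convex_onD[OF that]) auto
    moreover have "?R 0 = - \<delta>" by (simp add: residual_quadratic_def hinge_def)
    moreover have "(1 - y)\<^sup>2 + (1 + y)\<^sup>2 = 4"
      using y by (simp add: power2_eq_square algebra_simps)
    then have "?R v + ?R (- v) = 2 * \<gamma> - \<delta> * 4"
      using vQ[of v] vQ[of "- v"] v
      by (simp add: residual_quadratic_def hinge_def algebra_simps flip: distrib_left)
    ultimately show ?thesis by (simp add: algebra_simps)
  qed
  then show ?thesis using conv assms(3) by (simp add: largest_convex_coeff_def)
qed

lemma posdef_matrix_inv:
  fixes Q :: "real ^ 'n ^ 'n"
  assumes "posdef_matrix Q"
  shows "Q *v (matrix_inv Q *v x) = x"
proof -
  have "w = 0" if "Q *v w = 0" for w
    using assms that by (force simp: posdef_matrix_def)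
  then have "invertible Q"
    by (simp add: invertible_left_inverse matrix_left_invertible_ker)
  then have "Q ** matrix_inv Q = mat 1"
    unfolding invertible_def matrix_inv_def by (rule someI2_ex) simp
  then show ?thesis
    by (simp add: matrix_vector_mul_assoc)
qed

theorem theorem1:
  fixes Q :: "real ^ 'p ^ 'p" and x :: "real ^ 'p" and y :: real
  assumes "posdef_matrix Q" and "x \<noteq> 0" and "y \<in> {-1, 1}"
  shows "\<exists>\<gamma>. largest_convex_coeff Q x y \<gamma> \<and>
           \<gamma> = 1 / (x \<bullet> (matrix_inv Q *v x)) \<and>
           convex hull (W_set Q x y) = hull_set Q x y \<gamma>"
proof -
  define u where "u = matrix_inv Q *v x"
  define \<gamma> where "\<gamma> = 1 / (x \<bullet> u)"
  \<comment> \<open>The scaling normalises \<open>x \<bullet> v\<close> to 1.\<close>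
  define v where "v = \<gamma> *\<^sub>R u"
  have Qu: "Q *v u = x"
    unfolding u_def by (rule posdef_matrix_inv[OF assms(1)])
  then have "u \<noteq> 0" using assms(2) by auto
  then have xu: "0 < x \<bullet> u"
    using assms(1) Qu by (auto simp: posdef_matrix_def inner_commute)
  then have \<gamma>: "0 < \<gamma>" by (simp add: \<gamma>_def)
  have v: "Q *v v = \<gamma> *\<^sub>R x" "x \<bullet> v = 1"
    using Qu xu by (simp_all add: v_def \<gamma>_def matrix_vector_mult_scaleR)
  have sym: "transpose Q = Q" using assms(1) by (simp add: posdef_matrix_def)
  have y: "y\<^sup>2 = 1" using assms(3) by auto
  have L: "largest_convex_coeff Q x y \<gamma>"
    by (rule largest_convex_coeff_residual[OF assms(1) y \<gamma> v])
  \<comment> \<open>This set closes the cycle of inclusions: the hull lies in \<open>?C\<close>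
    because \<open>?C\<close> is convex, \<open>?C\<close> lies in \<open>hull_set\<close>, and
    \<open>hull_set\<close> lies in the hull. Convexity is thus never argued with extended
    reals.\<close>
  let ?C = "{(w, z, t). 0 \<le> z \<and> z \<le> 1 \<and> (\<forall>c\<ge>0. \<forall>d\<ge>0.
    residual_quadratic Q x y \<gamma> w + \<gamma> * (2 * c * hinge x y w - c\<^sup>2 * z)
      + \<gamma> * (- 2 * d * hinge x y w - d\<^sup>2 * (1 - z)) \<le> t)}"
  have "W_set Q x y \<subseteq> ?C"
  proof clarify
    fix w z t
    assume W: "(w, z, t) \<in> W_set Q x y"
    then have "0 \<le> z \<and> z \<le> 1" by (auto simp: W_set_def)
    then show "0 \<le> z \<and> z \<le> 1 \<and> (\<forall>c\<ge>0. \<forall>d\<ge>0.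
        residual_quadratic Q x y \<gamma> w + \<gamma> * (2 * c * hinge x y w - c\<^sup>2 * z)
          + \<gamma> * (- 2 * d * hinge x y w - d\<^sup>2 * (1 - z)) \<le> t)"
      using W_set_dual[OF less_imp_le[OF \<gamma>] W] by blast
  qed
  moreover have "convex ?C"
    using L by (intro convex_hull_set_dual) (simp add: largest_convex_coeff_def)
  ultimately have "convex hull (W_set Q x y) \<subseteq> ?C"
    by (rule hull_minimal)
  also have "?C \<subseteq> hull_set Q x y \<gamma>"
    using hull_set_dualI[OF \<gamma>] by blast
  finally have "convex hull (W_set Q x y) = hull_set Q x y \<gamma>"
    using hull_set_subset_convex_hull[OF sym y \<gamma> v] by blast
  then show ?thesis using L unfolding \<gamma>_def u_def by blast
qed

end
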